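(* For every non-standard probability assignment $p:\mathcal{L}\to\mathbb{R}$ there is a unique canonical model $\mathcal{M}_p=\langle\mathcal{P}(\mathrm{Lit}),\mu,v^+,v^-\rangle$ whose induced non-standard probability function $p_\mu$ satisfies $p=p_\mu$.
   Context: Let $\mathrm{Prop}$ be a fixed finite set of propositional variables, $\mathrm{Lit}=\mathrm{Prop}\cup\{\neg p\mid p\in\mathrm{Prop}\}$ the set of literals, and let $\mathcal{L}$ be the set of formulas generated by $\varphi::= p\mid\neg\varphi\mid\varphi\wedge\varphi$ with $p\in\mathrm{Prop}$; $\varphi\vee\psi$ abbreviates $\neg(\neg\varphi\wedge\neg\psi)$. Belnap-Dunn entailment: a double valuation is a pair of functions $v^+,v^-:\mathrm{Prop}\to\{0,1\}$ (arbitrary and independent of each other), extended to $\mathcal{L}$ by: $v^+(\neg\varphi)=1$ iff $v^-(\varphi)=1$; $v^-(\neg\varphi)=1$ iff $v^+(\varphi)=1$; $v^+(\varphi\wedge\psi)=1$ iff $v^+(\varphi)=1$ and $v^+(\psi)=1$; $v^-(\varphi\wedge\psi)=1$ iff $v^-(\varphi)=1$ or $v^-(\psi)=1$. Write $\varphi\vDash_L\psi$ iff for all double valuations, $v^+(\varphi)=1$ implies $v^+(\psi)=1$. A non-standard probability assignment is a function $p:\mathcal{L}\to\mathbb{R}$ such that for all $\varphi,\psi\in\mathcal{L}$: (A1) $0\le p(\varphi)\le 1$; (A2) if $\varphi\vDash_L\psi$ then $p(\varphi)\le p(\psi)$; (A3) $p(\varphi\wedge\psi)+p(\varphi\vee\psi)=p(\varphi)+p(\psi)$.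 A probabilistic model is a tuple $\langle\Sigma,\mu,v^+,v^-\rangle$ where $\Sigma$ is a finite or countably infinite set, $v^+,v^-:\Sigma\times\mathrm{Prop}\to\{0,1\}$ are arbitrary functions, and $\mu$ is a (classical) probability measure on the full power set of $\Sigma$. Relations $\models^+,\models^-$ between states $s\in\Sigma$ and formulas: $s\models^+p$ iff $v^+(s,p)=1$; $s\models^-p$ iff $v^-(s,p)=1$; $s\models^+\varphi\wedge\psi$ iff $s\models^+\varphi$ and $s\models^+\psi$; $s\models^-\varphi\wedge\psi$ iff $s\models^-\varphi$ or $s\models^-\psi$; $s\models^+\neg\varphi$ iff $s\models^-\varphi$; $s\models^-\neg\varphi$ iff $s\models^+\varphi$. The induced non-standard probability function is $p_\mu(\varphi)=\mu(\{s\in\Sigma: s\models^+\varphi\})$. A probabilistic model is canonical iff $\Sigma=\mathcal{P}(\mathrm{Lit})$ and, for all $q\in\mathrm{Prop}$ and $\sigma\subseteq\mathrm{Lit}$, $v^+(\sigma,q)=1$ iff $q\in\sigma$, and $v^-(\sigma,q)=1$ iff $\neg q\in\sigma$. (So canonical models differ only in $\mu$.) *)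

theory Defs
  imports "HOL-Probability.Probability"
begin

text \<open>The finite set of propositional variables is rendered as a type \<open>'q\<close> of class
  \<open>finite\<close>, and the truth values 0 and 1 as \<open>bool\<close>.\<close>

datatype 'q fm = Atom 'q | Neg "'q fm" | Conj "'q fm" "'q fm"

definition Disj :: "'q fm \<Rightarrow> 'q fm \<Rightarrow> 'q fm" where
  "Disj \<phi> \<psi> = Neg (Conj (Neg \<phi>) (Neg \<psi>))"

datatype 'q literal = PosLit 'q | NegLit 'q

text \<open>The extension of a double valuation \<open>(vp, vn)\<close> to all formulas;
  \<open>vp\<close> and \<open>vn\<close> are the positive and the negative valuation.\<close>

fun ext_pos :: "('q \<Rightarrow> bool) \<Rightarrow> ('q \<Rightarrow> bool) \<Rightarrow> 'q fm \<Rightarrow> bool"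
  and ext_neg :: "('q \<Rightarrow> bool) \<Rightarrow> ('q \<Rightarrow> bool) \<Rightarrow> 'q fm \<Rightarrow> bool"
where
  "ext_pos vp vn (Atom q) \<longleftrightarrow> vp q"
| "ext_pos vp vn (Neg \<phi>) \<longleftrightarrow> ext_neg vp vn \<phi>"
| "ext_pos vp vn (Conj \<phi> \<psi>) \<longleftrightarrow> ext_pos vp vn \<phi> \<and> ext_pos vp vn \<psi>"
| "ext_neg vp vn (Atom q) \<longleftrightarrow> vn q"
| "ext_neg vp vn (Neg \<phi>) \<longleftrightarrow> ext_pos vp vn \<phi>"
| "ext_neg vp vn (Conj \<phi> \<psi>) \<longleftrightarrow> ext_neg vp vn \<phi> \<or> ext_neg vp vn \<psi>"

definition entails :: "'q fm \<Rightarrow> 'q fm \<Rightarrow> bool" where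
  "entails \<phi> \<psi> \<longleftrightarrow> (\<forall>vp vn. ext_pos vp vn \<phi> \<longrightarrow> ext_pos vp vn \<psi>)"

definition nonstandard_prob_assignment :: "('q fm \<Rightarrow> real) \<Rightarrow> bool" where
  "nonstandard_prob_assignment p \<longleftrightarrow>
     (\<forall>\<phi>. 0 \<le> p \<phi> \<and> p \<phi> \<le> 1) \<and>
     (\<forall>\<phi> \<psi>. entails \<phi> \<psi> \<longrightarrow> p \<phi> \<le> p \<psi>) \<and>
     (\<forall>\<phi> \<psi>. p (Conj \<phi> \<psi>) + p (Disj \<phi> \<psi>) = p \<phi> + p \<psi>)"

record ('s, 'q) pre_model =
  states :: "'s set"
  msr :: "'s measure"
  vpos :: "'s \<Rightarrow> 'q \<Rightarrow> bool"
  vneg :: "'s \<Rightarrow> 'q \<Rightarrow> bool"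

definition probabilistic_model :: "('s, 'q) pre_model \<Rightarrow> bool" where
  "probabilistic_model M \<longleftrightarrow>
     countable (states M) \<and>
     prob_space (msr M) \<and> space (msr M) = states M \<and> sets (msr M) = Pow (states M)"

fun sat_pos :: "('s, 'q) pre_model \<Rightarrow> 's \<Rightarrow> 'q fm \<Rightarrow> bool"
  and sat_neg :: "('s, 'q) pre_model \<Rightarrow> 's \<Rightarrow> 'q fm \<Rightarrow> bool"
where
  "sat_pos M s (Atom q) \<longleftrightarrow> vpos M s q"
| "sat_pos M s (Neg \<phi>) \<longleftrightarrow> sat_neg M s \<phi>"
| "sat_pos M s (Conj \<phi> \<psi>) \<longleftrightarrow> sat_pos M s \<phi> \<and> sat_pos M s \<psi>"
| "sat_neg M s (Atom q) \<longleftrightarrow> vneg M s q"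
| "sat_neg M s (Neg \<phi>) \<longleftrightarrow> sat_pos M s \<phi>"
| "sat_neg M s (Conj \<phi> \<psi>) \<longleftrightarrow> sat_neg M s \<phi> \<or> sat_neg M s \<psi>"

definition induced_prob :: "('s, 'q) pre_model \<Rightarrow> 'q fm \<Rightarrow> real" where
  "induced_prob M \<phi> = measure (msr M) {s \<in> states M. sat_pos M s \<phi>}"

text \<open>Here \<open>states M\<close> is the whole type \<open>'q literal set\<close>, so the valuation fields have no
  unconstrained values and equality of canonical models as records is the intended one.\<close>

definition canonical_model :: "('q literal set, 'q) pre_model \<Rightarrow> bool" where
  "canonical_model M \<longleftrightarrow>
     probabilistic_model M \<and>
     states M = Pow (UNIV :: 'q literal set) \<and>
     (\<forall>\<sigma> q. vpos M \<sigma> q \<longleftrightarrow> PosLit q \<in> \<sigma>) \<and>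
     (\<forall>\<sigma> q. vneg M \<sigma> q \<longleftrightarrow> NegLit q \<in> \<sigma>)"

end

theory Submission
  imports Defs
begin

text \<open>
  A state of a canonical model is a set of literals, so ordering states by inclusion makes the
  truth set of every formula an up-set: formulas are built from literals by what amounts to
  intersections and unions (negation only swaps the two valuations). Conversely every up-set of
  states is the truth set of a formula, with exactly two exceptions: the empty set and the set of
  all states. No formula is true at the empty state and every formula is true at the state
  consisting of all literals, which is why these two are missed
  (\<open>truth_set_definable\<close>).

  An assignment \<open>p\<close> therefore is the same thing as a function on up-sets: by (A2), \<open>p \<phi>\<close>
  depends on the truth set of \<open>\<phi>\<close> only, (A2) is monotonicity and (A3) is modularity. On the two
  exceptional up-sets the values 0 and 1 are forced for a probability measure, and by (A1) they
  are compatible with monotonicity.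

  It remains to see that a monotone modular function \<open>F\<close> on the up-sets of a finite order, with
  \<open>F {} = 0\<close> and \<open>F UNIV = 1\<close>, comes from exactly one probability measure
  (\<open>upset_valuation_extends_uniquely\<close>). The sets \<open>{x..}\<close> and \<open>{x<..}\<close> are up-sets that
  differ in the point \<open>x\<close> only, so \<open>x\<close> must get the mass \<open>F {x..} - F {x<..}\<close>; this
  gives uniqueness, and monotonicity makes the mass nonnegative. That these masses add up to
  \<open>F U\<close> on each up-set \<open>U\<close> follows by removing minimal elements from \<open>U\<close> one at a time.
\<close>

section \<open>Valuations on the up-sets of a finite order\<close>

definition upset :: "'a::order set \<Rightarrow> bool" where
  "upset U \<longleftrightarrow> (\<forall>x\<in>U. \<forall>y. x \<le> y \<longrightarrow> y \<in> U)"

lemma upset_empty [simp]: "upset {}"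
  and upset_UNIV [simp]: "upset UNIV"
  and upset_atLeast [simp]: "upset {x..}"
  and upset_greaterThan [simp]: "upset {x<..}"
  by (auto simp: upset_def)

text \<open>If \<open>x\<close> is minimal in \<open>U\<close>, then \<open>U - {x}\<close> and \<open>{x..}\<close> have union \<open>U\<close> and
  intersection \<open>{x<..}\<close>, so modularity says that removing \<open>x\<close> costs exactly its mass.\<close>

lemma modular_eq_sum_upset:
  fixes F :: "'a::{finite,order} set \<Rightarrow> real"
  assumes empty: "F {} = 0"
    and modular: "\<And>U V. upset U \<Longrightarrow> upset V \<Longrightarrow> F (U \<inter> V) + F (U \<union> V) = F U + F V"
    and "upset U"
  shows "F U = (\<Sum>x\<in>U. F {x..} - F {x<..})"
  using finite[of U] \<open>upset U\<close>
proof (induction U rule: finite_psubset_induct)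
  case (psubset U)
  show ?case
  proof (cases "U = {}")
    case True
    then show ?thesis by (simp add: empty)
  next
    case False
    then obtain x where x: "x \<in> U" and min: "\<And>y. y \<in> U \<Longrightarrow> y \<le> x \<Longrightarrow> x = y"
      using finite_has_minimal[of U] by auto
    have up: "upset (U - {x})"
      unfolding upset_def
    proof (intro ballI allI impI)
      fix y z assume y: "y \<in> U - {x}" and "y \<le> z"
      then have "z \<in> U" using psubset.prems by (auto simp: upset_def)
      moreover have "z \<noteq> x" using min[of y] y \<open>y \<le> z\<close> by auto
      ultimately show "z \<in> U - {x}" by simp
    qed
    have "(U - {x}) \<inter> {x..} = {x<..}" and "(U - {x}) \<union> {x..} = U"
      using x psubset.prems by (auto simp: upset_def less_le)
    then have "F U = F (U - {x}) + (F {x..} - F {x<..})"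
      using modular[OF up upset_atLeast, of x] by simp
    also have "F (U - {x}) = (\<Sum>y\<in>U - {x}. F {y..} - F {y<..})"
      using x up by (intro psubset.IH) auto
    finally show ?thesis
      using x by (simp add: sum.remove[of U x])
  qed
qed

lemma measure_singleton_eq_upset_diff:
  fixes \<mu> :: "'a::{finite,order} measure"
  assumes "prob_space \<mu>" and sets: "sets \<mu> = UNIV"
  shows "measure \<mu> {x} = measure \<mu> {x..} - measure \<mu> {x<..}"
proof -
  interpret prob_space \<mu> by fact
  have "{x} = {x..} - {x<..}" by auto
  also have "measure \<mu> \<dots> = measure \<mu> {x..} - measure \<mu> {x<..}"
    by (rule finite_measure_Diff) (auto simp: sets)
  finally show ?thesis .
qed

theorem upset_valuation_extends_uniquely:
  fixes F :: "'a::{finite,order} set \<Rightarrow> real"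
  assumes empty: "F {} = 0" and UNIV: "F UNIV = 1"
    and mono: "\<And>U V. upset U \<Longrightarrow> upset V \<Longrightarrow> U \<subseteq> V \<Longrightarrow> F U \<le> F V"
    and modular: "\<And>U V. upset U \<Longrightarrow> upset V \<Longrightarrow> F (U \<inter> V) + F (U \<union> V) = F U + F V"
  shows "\<exists>!\<mu>. prob_space \<mu> \<and> sets \<mu> = UNIV \<and> (\<forall>U. upset U \<longrightarrow> measure \<mu> U = F U)"
proof (rule ex_ex1I)
  define m where "m x = F {x..} - F {x<..}" for x
  have m_nonneg: "0 \<le> m x" for x
    using mono[of "{x<..}" "{x..}"] by (simp add: m_def less_imp_le subset_iff)
  define \<mu> where "\<mu> = point_measure UNIV (\<lambda>x. ennreal (m x))"
  have emeasure: "emeasure \<mu> U = ennreal (F U)" if "upset U" for U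
  proof -
    have "emeasure \<mu> U = (\<Sum>x\<in>U. ennreal (m x))"
      unfolding \<mu>_def by (rule emeasure_point_measure_finite) auto
    also have "\<dots> = ennreal (\<Sum>x\<in>U. m x)"
      using m_nonneg by (intro sum_ennreal) auto
    also have "(\<Sum>x\<in>U. m x) = F U"
      using modular_eq_sum_upset[of F, OF empty modular that] by (simp add: m_def)
    finally show ?thesis .
  qed
  have "prob_space \<mu>"
    by (rule prob_spaceI) (use emeasure[of UNIV] UNIV in \<open>simp add: \<mu>_def space_point_measure\<close>)
  moreover have "sets \<mu> = UNIV"
    by (simp add: \<mu>_def sets_point_measure)
  moreover have "measure \<mu> U = F U" if "upset U" for U
    using emeasure[OF that] mono[of "{}" U] that by (simp add: measure_def empty)
  ultimately show "\<exists>\<mu>. prob_space \<mu> \<and> sets \<mu> = UNIV \<and> (\<forall>U. upset U \<longrightarrow> measure \<mu> U = F U)"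
    by blast
next
  fix \<mu> \<nu>
  assume \<mu>: "prob_space \<mu> \<and> sets \<mu> = UNIV \<and> (\<forall>U. upset U \<longrightarrow> measure \<mu> U = F U)"
    and \<nu>: "prob_space \<nu> \<and> sets \<nu> = UNIV \<and> (\<forall>U. upset U \<longrightarrow> measure \<nu> U = F U)"
  interpret \<mu>: prob_space \<mu> using \<mu> by blast
  interpret \<nu>: prob_space \<nu> using \<nu> by blast
  show "\<mu> = \<nu>"
  proof (rule measure_eqI_finite[of _ UNIV])
    fix x
    have "measure \<mu> {x} = measure \<nu> {x}"
      using \<mu> \<nu> by (simp add: measure_singleton_eq_upset_diff)
    then show "emeasure \<mu> {x} = emeasure \<nu> {x}"
      by (simp add: \<mu>.emeasure_eq_measure \<nu>.emeasure_eq_measure)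
  qed (use \<mu> \<nu> in auto)
qed

section \<open>Truth sets of formulas in the canonical state space\<close>

instance literal :: (finite) finite
proof
  have "(UNIV :: 'a literal set) = range PosLit \<union> range NegLit"
    by (metis UNIV_eq_I UnI1 UnI2 literal.exhaust rangeI)
  then show "finite (UNIV :: 'a literal set)"
    by (metis finite finite_Un finite_imageI)
qed

definition truth_set :: "'q fm \<Rightarrow> 'q literal set set" where
  "truth_set \<phi> = {\<sigma>. ext_pos (\<lambda>q. PosLit q \<in> \<sigma>) (\<lambda>q. NegLit q \<in> \<sigma>) \<phi>}"

lemma truth_set_Atom: "truth_set (Atom q) = {\<sigma>. PosLit q \<in> \<sigma>}"
  and truth_set_Neg_Atom: "truth_set (Neg (Atom q)) = {\<sigma>. NegLit q \<in> \<sigma>}"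
  and truth_set_Conj: "truth_set (Conj \<phi> \<psi>) = truth_set \<phi> \<inter> truth_set \<psi>"
  and truth_set_Disj: "truth_set (Disj \<phi> \<psi>) = truth_set \<phi> \<union> truth_set \<psi>"
  by (auto simp: truth_set_def Disj_def)

text \<open>Every double valuation is read off from a state, namely from the set of the literals
  that it supports.\<close>

lemma entails_iff_truth_set_subset: "entails \<phi> \<psi> \<longleftrightarrow> truth_set \<phi> \<subseteq> truth_set \<psi>"
proof
  show "entails \<phi> \<psi> \<Longrightarrow> truth_set \<phi> \<subseteq> truth_set \<psi>"
    by (auto simp: entails_def truth_set_def)
next
  assume sub: "truth_set \<phi> \<subseteq> truth_set \<psi>"
  show "entails \<phi> \<psi>"
    unfolding entails_def
  proof (intro allI impI)
    fix vp vn assume "ext_pos vp vn \<phi>"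
    define \<sigma> where "\<sigma> = {l. case l of PosLit q \<Rightarrow> vp q | NegLit q \<Rightarrow> vn q}"
    have "vp = (\<lambda>q. PosLit q \<in> \<sigma>)" "vn = (\<lambda>q. NegLit q \<in> \<sigma>)"
      by (simp_all add: \<sigma>_def)
    with \<open>ext_pos vp vn \<phi>\<close> sub show "ext_pos vp vn \<psi>"
      by (auto simp: truth_set_def)
  qed
qed

text \<open>Negation preserves monotonicity because it exchanges the two valuations instead of
  complementing a truth value.\<close>

lemma ext_mono:
  assumes "vp \<le> vp'" "vn \<le> vn'"
  shows "ext_pos vp vn \<phi> \<Longrightarrow> ext_pos vp' vn' \<phi>" and "ext_neg vp vn \<phi> \<Longrightarrow> ext_neg vp' vn' \<phi>"
  using assms by (induction \<phi>) (auto simp: le_fun_def)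

lemma upset_truth_set: "upset (truth_set \<phi>)"
  unfolding upset_def truth_set_def
  by (auto elim!: ext_mono(1)[rotated 2] simp: le_fun_def)

lemma ext_all_false:
  "\<not> ext_pos (\<lambda>_. False) (\<lambda>_. False) \<phi>" "\<not> ext_neg (\<lambda>_. False) (\<lambda>_. False) \<phi>"
  by (induction \<phi>) auto

lemma ext_all_true:
  "ext_pos (\<lambda>_. True) (\<lambda>_. True) \<phi>" "ext_neg (\<lambda>_. True) (\<lambda>_. True) \<phi>"
  by (induction \<phi>) auto

lemma truth_set_neq_empty: "truth_set \<phi> \<noteq> {}"
proof -
  have "UNIV \<in> truth_set \<phi>" by (simp add: truth_set_def ext_all_true)
  then show ?thesis by blast
qed

lemma truth_set_neq_UNIV: "truth_set \<phi> \<noteq> UNIV"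
proof -
  have "{} \<notin> truth_set \<phi>" by (simp add: truth_set_def ext_all_false)
  then show ?thesis by blast
qed

lemma finite_Inter_definable:
  assumes "finite S" "S \<noteq> {}" "S \<subseteq> range truth_set"
  shows "\<Inter>S \<in> range truth_set"
  using assms
  by (induction rule: finite_ne_induct) (auto simp flip: truth_set_Conj)

lemma finite_Union_definable:
  assumes "finite S" "S \<noteq> {}" "S \<subseteq> range truth_set"
  shows "\<Union>S \<in> range truth_set"
  using assms
  by (induction rule: finite_ne_induct) (auto simp flip: truth_set_Disj)

text \<open>Disjunctive normal form: the conjunction of the literals in \<open>\<sigma>\<close> defines the states above
  \<open>\<sigma>\<close>, and an up-set is the union of the principal up-sets of its elements. Empty conjunctions
  and disjunctions are the only obstacle.\<close>

lemma truth_set_definable: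
  fixes U :: "'q::finite literal set set"
  assumes "upset U" "U \<noteq> {}" "U \<noteq> UNIV"
  obtains \<phi> where "U = truth_set \<phi>"
proof -
  have literal: "{\<sigma>. l \<in> \<sigma>} \<in> range truth_set" for l :: "'q literal"
    by (cases l) (auto simp flip: truth_set_Atom truth_set_Neg_Atom)
  have principal: "{\<sigma>..} \<in> range truth_set" if "\<sigma> \<in> U" for \<sigma>
  proof -
    have "\<sigma> \<noteq> {}"
      using that \<open>upset U\<close> \<open>U \<noteq> UNIV\<close> by (auto simp: upset_def)
    moreover have "{\<sigma>..} = \<Inter>((\<lambda>l. {\<tau>. l \<in> \<tau>}) ` \<sigma>)"
      by auto
    ultimately show ?thesis
      using finite_Inter_definable[of "(\<lambda>l. {\<tau>. l \<in> \<tau>}) ` \<sigma>"] literal by auto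
  qed
  have "U = \<Union>(atLeast ` U)"
    using \<open>upset U\<close> by (auto simp: upset_def)
  also have "\<dots> \<in> range truth_set"
    using \<open>U \<noteq> {}\<close> principal by (intro finite_Union_definable) auto
  finally show ?thesis using that by blast
qed

section \<open>Assignments as valuations on up-sets\<close>

text \<open>The choice of the defining formula is immaterial for a nonstandard probability assignment
  (\<open>upset_value_truth_set\<close>).\<close>

definition upset_value :: "('q fm \<Rightarrow> real) \<Rightarrow> 'q literal set set \<Rightarrow> real" where
  "upset_value p U =
     (if U = {} then 0 else if U = UNIV then 1 else p (SOME \<phi>. truth_set \<phi> = U))"

context
  fixes p :: "'q::finite fm \<Rightarrow> real"
  assumes p: "nonstandard_prob_assignment p"
begin

lemma upset_value_truth_set: "upset_value p (truth_set \<phi>) = p \<phi>"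
proof -
  have "truth_set (SOME \<psi>. truth_set \<psi> = truth_set \<phi>) = truth_set \<phi>"
    by (rule someI[where P = "\<lambda>\<psi>. truth_set \<psi> = truth_set \<phi>"]) simp
  then have "p (SOME \<psi>. truth_set \<psi> = truth_set \<phi>) = p \<phi>"
    using p unfolding nonstandard_prob_assignment_def entails_iff_truth_set_subset
    by (intro antisym) auto
  then show ?thesis
    by (simp add: upset_value_def truth_set_neq_empty truth_set_neq_UNIV)
qed

lemma upset_cases:
  fixes U :: "'q literal set set"
  assumes "upset U"
  obtains "U = {}" | "U = UNIV" | \<phi> where "U = truth_set \<phi>"
  using assms truth_set_definable by metis

lemma upset_value_empty: "upset_value p {} = 0"
  and upset_value_UNIV: "upset_value p UNIV = 1"
  by (simp_all add: upset_value_def)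

lemma upset_value_bounds:
  assumes "upset U"
  shows "0 \<le> upset_value p U" "upset_value p U \<le> 1"
  using assms p
  by (auto elim!: upset_cases simp: upset_value_truth_set upset_value_empty upset_value_UNIV
      nonstandard_prob_assignment_def)

lemma upset_value_mono:
  assumes "upset U" "upset V" "U \<subseteq> V"
  shows "upset_value p U \<le> upset_value p V"
proof (cases rule: upset_cases[OF \<open>upset U\<close>])
  case 1
  then show ?thesis using upset_value_bounds[of V] assms by (simp add: upset_value_empty)
next
  case 2
  then show ?thesis using assms by (simp add: top.extremum_unique)
next
  case U: (3 \<phi>)
  show ?thesis
  proof (cases rule: upset_cases[OF \<open>upset V\<close>])
    case 1
    then show ?thesis using U assms truth_set_neq_empty by auto
  next
    case 2
    then show ?thesis using upset_value_bounds[of U] assms by (simp add: upset_value_UNIV)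
  next
    case V: (3 \<psi>)
    then show ?thesis
      using U assms p
      by (simp add: upset_value_truth_set nonstandard_prob_assignment_def
          entails_iff_truth_set_subset)
  qed
qed

lemma upset_value_modular:
  assumes "upset U" "upset V"
  shows "upset_value p (U \<inter> V) + upset_value p (U \<union> V) = upset_value p U + upset_value p V"
proof (cases "U \<in> {{}, UNIV} \<or> V \<in> {{}, UNIV}")
  case True
  then show ?thesis by auto
next
  case False
  then obtain \<phi> \<psi> where "U = truth_set \<phi>" "V = truth_set \<psi>"
    using assms truth_set_definable by (metis insertCI)
  then show ?thesis
    using p by (simp flip: truth_set_Conj truth_set_Disj
        add: upset_value_truth_set nonstandard_prob_assignment_def)
qed

end

section \<open>Canonical models\<close>

definition canonical_model_of ::
    "'q literal set measure \<Rightarrow> ('q literal set, 'q) pre_model" where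
  "canonical_model_of \<mu> =
     \<lparr>states = UNIV, msr = \<mu>, vpos = (\<lambda>\<sigma> q. PosLit q \<in> \<sigma>), vneg = (\<lambda>\<sigma> q. NegLit q \<in> \<sigma>)\<rparr>"

lemma canonical_model_iff:
  fixes M :: "('q::finite literal set, 'q) pre_model"
  shows "canonical_model M \<longleftrightarrow>
    M = canonical_model_of (msr M) \<and> prob_space (msr M) \<and> sets (msr M) = UNIV"
proof -
  have "space \<mu> = UNIV" if "sets \<mu> = UNIV" for \<mu> :: "'q literal set measure"
    using sets.sets_into_space[of UNIV \<mu>] that by auto
  then show ?thesis
    by (cases M) (auto simp: canonical_model_def canonical_model_of_def
        probabilistic_model_def fun_eq_iff)
qed

lemma sat_eq_ext:
  "sat_pos M s \<phi> \<longleftrightarrow> ext_pos (vpos M s) (vneg M s) \<phi>"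
  "sat_neg M s \<phi> \<longleftrightarrow> ext_neg (vpos M s) (vneg M s) \<phi>"
  by (induction \<phi>) auto

lemma induced_prob_canonical_model_of:
  "induced_prob (canonical_model_of \<mu>) \<phi> = measure \<mu> (truth_set \<phi>)"
  by (simp add: induced_prob_def sat_eq_ext canonical_model_of_def truth_set_def)

text \<open>On the two up-sets that no formula defines, a probability measure agrees with
  \<open>upset_value p\<close> automatically.\<close>

lemma induced_prob_eq_iff:
  fixes p :: "'q::finite fm \<Rightarrow> real"
  assumes p: "nonstandard_prob_assignment p"
    and "prob_space \<mu>" and sets: "sets \<mu> = UNIV"
  shows "p = induced_prob (canonical_model_of \<mu>) \<longleftrightarrow>
    (\<forall>U. upset U \<longrightarrow> measure \<mu> U = upset_value p U)"
proof -
  interpret prob_space \<mu> by fact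
  have "measure \<mu> UNIV = 1"
    using prob_space sets.sets_into_space[of UNIV \<mu>] sets by (simp add: top.extremum_unique)
  moreover have "p = induced_prob (canonical_model_of \<mu>) \<longleftrightarrow>
      (\<forall>\<phi>. measure \<mu> (truth_set \<phi>) = upset_value p (truth_set \<phi>))"
    by (auto simp: fun_eq_iff induced_prob_canonical_model_of upset_value_truth_set[OF p])
  moreover have "(\<forall>\<phi>. measure \<mu> (truth_set \<phi>) = upset_value p (truth_set \<phi>)) \<longrightarrow>
      measure \<mu> U = upset_value p U" if "upset U" for U
    by (rule upset_cases[OF p that])
      (use \<open>measure \<mu> UNIV = 1\<close> in
        \<open>auto simp: upset_value_empty[OF p] upset_value_UNIV[OF p]\<close>)
  ultimately show ?thesis
    using upset_truth_set by blast
qed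

theorem theorem4:
  fixes p :: "'q::finite fm \<Rightarrow> real"
  assumes "nonstandard_prob_assignment p"
  shows "\<exists>!M :: ('q literal set, 'q) pre_model. canonical_model M \<and> p = induced_prob M"
proof -
  let ?represents = "\<lambda>\<mu> :: 'q literal set measure.
    prob_space \<mu> \<and> sets \<mu> = UNIV \<and> (\<forall>U. upset U \<longrightarrow> measure \<mu> U = upset_value p U)"
  have "\<exists>!\<mu>. ?represents \<mu>"
    by (intro upset_valuation_extends_uniquely upset_value_empty upset_value_UNIV
        upset_value_mono upset_value_modular assms)
  moreover have "canonical_model M \<and> p = induced_prob M \<longleftrightarrow>
      M = canonical_model_of (msr M) \<and> ?represents (msr M)" for M
    using induced_prob_eq_iff[OF assms, of "msr M"] by (metis canonical_model_iff)
  moreover have "msr (canonical_model_of \<mu>) = \<mu>" for \<mu> :: "'q literal set measure"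
    by (simp add: canonical_model_of_def)
  ultimately show ?thesis
    by metis
qed

end
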